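(* Let $n\ge 1$ and $\lambda\in[1/(n+1),1/2]$. Let $P\subseteq\mathbb{R}^n$ be a polytope and let $F$ be a (non-empty) face of $P$. Assume $F\subseteq(1-\lambda)P+\lambda V(P)$. Then $F=(1-\lambda)F+\lambda V(F)$. In particular, faces of $\lambda$-vertex generated polytopes are $\lambda$-vertex generated.
   Context: A polytope in $\mathbb{R}^n$ is the convex hull of a finite non-empty set of points (it need not have non-empty interior); $V(P)$ denotes the set of vertices of $P$; $A+B=\{a+b: a\in A,b\in B\}$ is the Minkowski sum. For a polytope $P\subset\mathbb{R}^n$ let $\lambda(P)=\sup\{\lambda\in\mathbb{R}: P=(1-\lambda)P+\lambda V(P)\}$ (value in $(-\infty,+\infty]$; it is $+\infty$ exactly when $P$ is a single point). $P$ is called $\lambda$-vertex generated if $\lambda(P)\ge\lambda$. *)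

theory Defs
  imports "HOL-Analysis.Analysis"
begin

definition vertex_set :: "'a::euclidean_space set \<Rightarrow> 'a set"
  where "vertex_set P = {v. v extreme_point_of P}"

text \<open>The set \<open>(1 - l) P + l V(P)\<close>; \<open>+\<close> on sets is the Minkowski sum.\<close>

definition vertex_shrink :: "real \<Rightarrow> 'a::euclidean_space set \<Rightarrow> 'a set"
  where "vertex_shrink l P = (*\<^sub>R) (1 - l) ` P + (*\<^sub>R) l ` vertex_set P"

text \<open>The supremum is taken in the extended reals, over all real \<open>l\<close> without sign or size
  restriction, so it is \<open>\<infinity>\<close> for a single point.\<close>

definition vertex_lambda :: "'a::euclidean_space set \<Rightarrow> ereal"
  where "vertex_lambda P = (SUP l \<in> {l::real. P = vertex_shrink l P}. ereal l)"

definition vertex_generated :: "real \<Rightarrow> 'a::euclidean_space set \<Rightarrow> bool"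
  where "vertex_generated l P \<longleftrightarrow> vertex_lambda P \<ge> ereal l"

end

theory Submission
  imports Defs
begin

text \<open>Write a point x of F as \<open>(1 - m) *\<^sub>R p + m *\<^sub>R v\<close> with p in P
  and v a vertex of P. For 0 < m < 1 either p = v = x or x lies strictly between p and v, and then
  the face property puts both into F; a vertex of P lying in F is a vertex of F. The other inclusion
  is convexity. This is \<open>face_of_subset_vertex_shrink\<close>. For vertex generation, no
  attained supremum is needed: it suffices that each positive m with
  \<open>P = vertex_shrink m P\<close> also satisfies the equation for F. If m < 1, the first
  argument applies; if m \<ge> 1, P is a single point
  (\<open>vertex_shrink_fixed_imp_singleton\<close>) and F = P.\<close>

lemma vertex_shrinkE:
  assumes "x \<in> vertex_shrink m P"
  obtains p v where "p \<in> P" "v extreme_point_of P" "x = (1 - m) *\<^sub>R p + m *\<^sub>R v"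
  using assms unfolding vertex_shrink_def vertex_set_def by (auto elim!: set_plus_elim)

lemma vertex_shrinkI:
  assumes "p \<in> P" "v extreme_point_of P"
  shows "(1 - m) *\<^sub>R p + m *\<^sub>R v \<in> vertex_shrink m P"
  using assms unfolding vertex_shrink_def vertex_set_def by auto

lemma vertex_shrink_subset:
  assumes "convex P" "0 \<le> m" "m \<le> 1"
  shows "vertex_shrink m P \<subseteq> P"
proof
  fix x
  assume "x \<in> vertex_shrink m P"
  then obtain p v where "p \<in> P" "v extreme_point_of P" "x = (1 - m) *\<^sub>R p + m *\<^sub>R v"
    by (rule vertex_shrinkE)
  then show "x \<in> P"
    using assms by (auto simp: extreme_point_of_def intro!: convexD)
qed

lemma face_of_subset_vertex_shrink:
  assumes face: "F face_of P" and m: "0 < m" "m < 1"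
    and sub: "F \<subseteq> vertex_shrink m P"
  shows "F = vertex_shrink m F"
proof
  show "vertex_shrink m F \<subseteq> F"
    using m face_of_imp_convex[OF face] by (intro vertex_shrink_subset) auto
  show "F \<subseteq> vertex_shrink m F"
  proof
    fix x
    assume x: "x \<in> F"
    with sub obtain p v where pv: "p \<in> P" "v extreme_point_of P"
      and x_eq: "x = (1 - m) *\<^sub>R p + m *\<^sub>R v"
      by (blast elim: vertex_shrinkE)
    have "p \<in> F \<and> v \<in> F"
    proof (cases "p = v")
      case True
      with x x_eq show ?thesis
        by (simp add: algebra_simps)
    next
      case False
      with x_eq m have "x \<in> open_segment p v"
        by (auto simp: in_segment)
      with face x pv show ?thesis
        by (auto simp: extreme_point_of_def dest: face_ofD)
    qed
    \<comment> \<open>The extreme points of a face are exactly the extreme points of P that lie in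
      it.\<close>
    with pv face x_eq show "x \<in> vertex_shrink m F"
      by (auto simp: extreme_point_of_face intro!: vertex_shrinkI)
  qed
qed

text \<open>Handles the parameters for which x is no longer strictly between p and v. At m = 1 all
  points of P are extreme, so no two distinct points can have their midpoint in P; beyond 1, moving
  from another point past a vertex would leave P.\<close>

lemma vertex_shrink_fixed_imp_singleton:
  assumes "convex P" "P \<noteq> {}" "1 \<le> m" and fixed: "P = vertex_shrink m P"
  obtains v where "P = {v}"
proof (cases "m = 1")
  case True
  have ext: "v extreme_point_of P" if "v \<in> P" for v
  proof -
    from that fixed have "v \<in> vertex_shrink m P"
      by blast
    with True show ?thesis
      by (auto elim: vertex_shrinkE)
  qed
  from \<open>P \<noteq> {}\<close> obtain v where v: "v \<in> P"
    by blast
  have "q = v" if q: "q \<in> P" for q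
  proof -
    have "midpoint v q \<in> P"
      using closed_segment_subset[OF v q \<open>convex P\<close>] midpoint_in_closed_segment by blast
    from ext[OF this] v q have "midpoint v q \<notin> open_segment v q"
      unfolding extreme_point_of_def by blast
    then show ?thesis
      by simp
  qed
  with v that show ?thesis
    by blast
next
  case False
  with \<open>1 \<le> m\<close> have m: "1 < m"
    by simp
  from \<open>P \<noteq> {}\<close> fixed obtain x where "x \<in> vertex_shrink m P"
    by blast
  then obtain v where v: "v extreme_point_of P"
    by (rule vertex_shrinkE)
  have "p = v" if p: "p \<in> P" for p
  proof (rule ccontr)
    assume "p \<noteq> v"
    \<comment> \<open>The fixed-point equation extrapolates from \<open>p\<close> through \<open>v\<close> while staying inside \<open>P\<close>.\<close>
    define w where "w = (1 - m) *\<^sub>R p + m *\<^sub>R v"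
    have w: "w \<in> P"
      using vertex_shrinkI[OF p v] fixed w_def by blast
    have w_diff: "w - p = m *\<^sub>R (v - p)"
      by (simp add: w_def algebra_simps)
    with \<open>p \<noteq> v\<close> m have "p \<noteq> w"
      by auto
    \<comment> \<open>Solving the definition of \<open>w\<close> for v gives the ratio 1 / m, which
      lies in (0, 1) because m > 1; so the vertex v would be inside a segment of P.\<close>
    moreover have "v = (1 - 1 / m) *\<^sub>R p + (1 / m) *\<^sub>R w"
    proof -
      have "v - p = (1 / m) *\<^sub>R (w - p)"
        using m by (simp add: w_diff)
      then show ?thesis
        by (simp add: algebra_simps)
    qed
    moreover have "0 < 1 / m" "1 / m < 1"
      using m by auto
    ultimately have "v \<in> open_segment p w"
      unfolding in_segment by blast
    with v p w show False
      unfolding extreme_point_of_def by blast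
  qed
  moreover from v have "v \<in> P"
    by (simp add: extreme_point_of_def)
  ultimately show ?thesis
    using that by blast
qed

lemma face_of_vertex_shrink_fixed:
  assumes "convex P" "F face_of P" "F \<noteq> {}" "0 < m" and fixed: "P = vertex_shrink m P"
  shows "F = vertex_shrink m F"
proof (cases "m < 1")
  case True
  have "F \<subseteq> vertex_shrink m P"
    using assms(2) fixed face_of_imp_subset by blast
  with assms(2,4) True show ?thesis
    by (rule face_of_subset_vertex_shrink)
next
  case False
  have sub: "F \<subseteq> P"
    using assms(2) by (rule face_of_imp_subset)
  with \<open>F \<noteq> {}\<close> have "P \<noteq> {}"
    by blast
  with False \<open>convex P\<close> fixed obtain v where "P = {v}"
    by (meson vertex_shrink_fixed_imp_singleton not_less)
  with sub \<open>F \<noteq> {}\<close> have "F = P"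
    by auto
  with fixed show ?thesis
    by blast
qed

lemma face_of_vertex_generated:
  assumes "convex P" "F face_of P" "F \<noteq> {}" "0 < l" and gen: "vertex_generated l P"
  shows "vertex_generated l F"
  unfolding vertex_generated_def vertex_lambda_def le_SUP_iff
proof (intro allI impI)
  \<comment> \<open>The supremum is approximated from below. Replacing y by \<open>max y 0\<close>
    makes the parameter m found for P positive, as the transfer to F requires.\<close>
  fix y
  assume "y < ereal l"
  with \<open>0 < l\<close> have "max y 0 < ereal l"
    by simp
  with gen obtain m where m: "P = vertex_shrink m P" "max y 0 < ereal m"
    unfolding vertex_generated_def vertex_lambda_def le_SUP_iff by blast
  from m(2) have "0 < m" "y < ereal m"
    by auto
  moreover from \<open>0 < m\<close> have "F = vertex_shrink m F"
    using face_of_vertex_shrink_fixed[OF assms(1-3) _ m(1)] by blast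
  ultimately show "\<exists>i\<in>{m. F = vertex_shrink m F}. y < ereal i"
    by blast
qed

theorem lemma2p2:
  fixes P F :: "(real ^ 'n) set" and l :: real
  assumes "1 / (real CARD('n) + 1) \<le> l" and "l \<le> 1 / 2"
    and "polytope P" and "P \<noteq> {}"
    and "F face_of P" and "F \<noteq> {}"
  shows "(F \<subseteq> vertex_shrink l P \<longrightarrow> F = vertex_shrink l F) \<and>
         (vertex_generated l P \<longrightarrow> vertex_generated l F)"
proof -
  have "0 < 1 / (real CARD('n) + 1)"
    by (simp add: add_nonneg_pos)
  with assms(1,2) have "0 < l" "l < 1"
    by linarith+
  then show ?thesis
    using face_of_subset_vertex_shrink[OF assms(5)]
      face_of_vertex_generated[OF polytope_imp_convex[OF assms(3)] assms(5,6)]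
    by blast
qed

end
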